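(* Let $A$ be a finite alphabet. For every sentence $I$ over $A$, the coproduct of the coloured non-commutative elementary symmetric function $E_I$ in $\mathrm{NSym}_A$ is $$\Delta(E_I)=\sum_{J\subset I}E_{\widetilde J}\otimes E_{\widetilde{I\setminus J}},$$ which in the case of a single word $a_{i_1}a_{i_2}\cdots a_{i_k}$ with letters in $A$ gives $$\Delta(E_{(a_{i_1}a_{i_2}\cdots a_{i_k})})=\sum_{j=0}^{k}E_{(a_{i_{j+1}}\cdots a_{i_k})}\otimes E_{(a_{i_1}a_{i_2}\cdots a_{i_j})}.$$
   Context: $\Bbbk$ is a field of characteristic zero. A sentence $I=(w_1,\dots,w_m)$ over $A$ is a finite sequence of non-empty words in letters of $A$; $1$ is the empty sentence. $\ell(I)=m$, and $|I|$ is the total number of letters. $I\cdot J$ is concatenation of sequences of words. Write $J\preccurlyeq I$ ($J$ refines $I$) if the words of $I$ can be obtained by concatenating adjacent words of $J$. A weak sentence is a finite sequence of possibly empty words; $\widetilde J$ is obtained from $J$ by deleting the empty words. For a sentence $I=(w_1,\dots,w_m)$, a weak sentence $J=(v_1,\dots,v_m)$ satisfies $J\subset I$ if there is a weak sentence $I\setminus J:=(u_1,\dots,u_m)$ with $w_i=u_iv_i$ for all $i$. $\mathrm{NSym}_A$ is the Hopf algebra over $\Bbbk$ with linear basis $(H_I)$ indexed by sentences, product $H_I\cdot H_J=H_{I\cdot J}$, and coproduct $\Delta(H_I)=\sum_{J\subset I}H_{\widetilde{I\setminus J}}\otimes H_{\widetilde J}$. The elementary functions are $E_I=\sum_{J\preccurlyeq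 I}(-1)^{|I|-\ell(J)}H_J$. An index consisting of an empty word is read as the empty sentence, and $E_1=1$. *)

theory Defs
  imports Complex_Main "HOL-Library.Poly_Mapping"
begin

section \<open>Sentences\<close>

typedef 'a sentence = "{I :: 'a list list. [] \<notin> set I}"
  morphisms words Sentence
  by (rule exI[of _ "[]"]) simp

setup_lifting type_definition_sentence

text \<open>Sentences form a monoid under concatenation; it is written additively because
  \<^theory>\<open>HOL-Library.Poly_Mapping\<close> builds monoid algebras from additive monoids.  Thus
  \<^term>\<open>0\<close> is the empty sentence (written 1 in the mathematics) and \<^term>\<open>I + J\<close> is
  the concatenation \<open>I \<cdot> J\<close>.\<close>

instantiation sentence :: (type) monoid_add
begin

lift_definition zero_sentence :: "'a sentence" is "[]" by simp

lift_definition plus_sentence :: "'a sentence \<Rightarrow> 'a sentence \<Rightarrow> 'a sentence" is "(@)"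
  by simp

instance by standard (transfer, simp)+

end

definition sentences :: "'a set \<Rightarrow> 'a sentence set" where
  "sentences A = {I. set (concat (words I)) \<subseteq> A}"

definition sentence_length :: "'a sentence \<Rightarrow> nat" where
  "sentence_length I = length (words I)"

definition sentence_size :: "'a sentence \<Rightarrow> nat" where
  "sentence_size I = length (concat (words I))"

text \<open>\<^term>\<open>G\<close> groups the words of \<^term>\<open>J\<close> into consecutive blocks, each of which is
  concatenated to one word of \<^term>\<open>I\<close>.\<close>

definition refines :: "'a sentence \<Rightarrow> 'a sentence \<Rightarrow> bool" (infix "\<preceq>" 50) where
  "J \<preceq> I \<longleftrightarrow> (\<exists>G. concat G = words J \<and> map concat G = words I)"


section \<open>Weak sentences\<close>

type_synonym 'a weak_sentence = "'a list list"

text \<open>\<open>strip\<close> deletes the empty words (the tilde operation).  As \<open>strip [[]]\<close> is the empty sentence, indexing by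
  \<open>strip [w]\<close> also encodes the convention that an index consisting of an empty word is
  read as the empty sentence.\<close>

lift_definition strip :: "'a weak_sentence \<Rightarrow> 'a sentence" is "filter (\<lambda>w. w \<noteq> [])"
  by simp

definition is_complement :: "'a sentence \<Rightarrow> 'a weak_sentence \<Rightarrow> 'a weak_sentence \<Rightarrow> bool" where
  "is_complement I J U \<longleftrightarrow>
     length J = length (words I) \<and> length U = length (words I) \<and>
     (\<forall>i < length (words I). words I ! i = U ! i @ J ! i)"

definition weak_sub :: "'a weak_sentence \<Rightarrow> 'a sentence \<Rightarrow> bool" (infix "\<sqsubset>" 50) where
  "J \<sqsubset> I \<longleftrightarrow> (\<exists>U. is_complement I J U)"

definition complement :: "'a sentence \<Rightarrow> 'a weak_sentence \<Rightarrow> 'a weak_sentence"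
    (infixl "\<setminus>" 65) where
  "I \<setminus> J = (THE U. is_complement I J U)"

lemma is_complement_unique: "is_complement I J U \<Longrightarrow> is_complement I J V \<Longrightarrow> U = V"
  unfolding is_complement_def by (metis append_same_eq nth_equalityI)

lemma complement_eqI: "is_complement I J U \<Longrightarrow> I \<setminus> J = U"
  unfolding complement_def using is_complement_unique by blast

lemma is_complement_complement: "J \<sqsubset> I \<Longrightarrow> is_complement I J (I \<setminus> J)"
  unfolding weak_sub_def using complement_eqI by blast

lemma finite_bounded_lists:
  "finite {xs :: 'a list list. length xs \<le> n \<and> (\<forall>w \<in> set xs. set w \<subseteq> B \<and> length w \<le> m)}"
  if "finite B"
proof -
  have "finite {w. set w \<subseteq> B \<and> length w \<le> m}"
    using that by (rule finite_lists_length_le)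
  from finite_lists_length_le[OF this, of n] show ?thesis
    by (rule rev_finite_subset) auto
qed

lemma finite_weak_sub: "finite {J. J \<sqsubset> I}"
proof -
  let ?B = "set (concat (words I))" and ?m = "length (concat (words I))"
  have "set w \<subseteq> ?B \<and> length w \<le> ?m" if J: "J \<sqsubset> I" and w: "w \<in> set J" for J w
  proof -
    obtain U where U: "is_complement I J U" using J by (auto simp: weak_sub_def)
    obtain i where i: "i < length J" "w = J ! i" using w by (auto simp: in_set_conv_nth)
    have e: "words I ! i = U ! i @ w"
      using U i by (auto simp: is_complement_def)
    have m: "words I ! i \<in> set (words I)"
      using U i by (intro nth_mem) (simp add: is_complement_def)
    have "length (words I ! i) \<le> ?m"
      using m by (simp add: length_concat member_le_sum_list)
    then show ?thesis using e m by auto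
  qed
  then have "{J. J \<sqsubset> I} \<subseteq>
      {xs. length xs \<le> length (words I) \<and> (\<forall>w \<in> set xs. set w \<subseteq> ?B \<and> length w \<le> ?m)}"
    by (auto simp: weak_sub_def is_complement_def)
  then show ?thesis
    by (rule finite_subset) (rule finite_bounded_lists, simp)
qed

lemma refines_concat: "concat (words J) = concat (words I)" if "J \<preceq> I"
proof -
  have "concat (concat G) = concat (map concat G)" for G :: "'a list list list"
    by (induction G) auto
  with that show ?thesis unfolding refines_def by metis
qed

lemma length_le_length_concat: "[] \<notin> set xs \<Longrightarrow> length xs \<le> length (concat xs)"
proof (induction xs)
  case (Cons w xs)
  then show ?case by (cases w) auto
qed simp

lemma sentence_length_le_size: "sentence_length I \<le> sentence_size I"
  using words[of I] by (simp add: sentence_length_def sentence_size_def length_le_length_concat)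

lemma finite_refines: "finite {J. J \<preceq> I}"
proof (rule finite_imageD)
  let ?B = "set (concat (words I))" and ?m = "length (concat (words I))"
  have "length (words J) \<le> ?m" "\<And>w. w \<in> set (words J) \<Longrightarrow> set w \<subseteq> ?B \<and> length w \<le> ?m"
    if "J \<preceq> I" for J
    using that sentence_length_le_size[of J]
    by (auto simp: refines_concat[OF that, symmetric] sentence_length_def sentence_size_def
        length_concat member_le_sum_list)
  then have "words ` {J. J \<preceq> I} \<subseteq>
      {xs. length xs \<le> ?m \<and> (\<forall>w \<in> set xs. set w \<subseteq> ?B \<and> length w \<le> ?m)}"
    by blast
  then show "finite (words ` {J. J \<preceq> I})"
    by (rule finite_subset) (rule finite_bounded_lists, simp)
  show "inj_on words {J. J \<preceq> I}"
    by (simp add: inj_on_def words_inject)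
qed


section \<open>Free vector spaces\<close>

definition scale :: "'k \<Rightarrow> ('b \<Rightarrow>\<^sub>0 'k) \<Rightarrow> ('b \<Rightarrow>\<^sub>0 'k::field)" where
  "scale c = Poly_Mapping.map ((*) c)"

lemma lookup_scale [simp]:
  "Poly_Mapping.lookup (scale c x) b = c * Poly_Mapping.lookup x b"
  by (simp add: scale_def Poly_Mapping.map.rep_eq when_def)

global_interpretation free_vs: vector_space "scale :: 'k::field \<Rightarrow> ('b \<Rightarrow>\<^sub>0 'k) \<Rightarrow> _"
  by unfold_locales
    (rule poly_mapping_eqI, simp add: lookup_add algebra_simps)+

text \<open>The linear map with prescribed values \<^term>\<open>f\<close> on the basis.\<close>

definition linear_extension :: "('b \<Rightarrow> ('c \<Rightarrow>\<^sub>0 'k)) \<Rightarrow> ('b \<Rightarrow>\<^sub>0 'k) \<Rightarrow> ('c \<Rightarrow>\<^sub>0 'k::field)" where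
  "linear_extension f x =
     (\<Sum>b \<in> Poly_Mapping.keys x. scale (Poly_Mapping.lookup x b) (f b))"

lemma linear_extension_superset:
  assumes "finite B" "Poly_Mapping.keys x \<subseteq> B"
  shows "linear_extension f x = (\<Sum>b \<in> B. scale (Poly_Mapping.lookup x b) (f b))"
  unfolding linear_extension_def
  using assms by (intro sum.mono_neutral_left) (auto simp: in_keys_iff)

lemma linear_linear_extension:
  fixes f :: "'b \<Rightarrow> ('c \<Rightarrow>\<^sub>0 'k::field)"
  shows "Vector_Spaces.linear scale scale (linear_extension f)"
proof unfold_locales
  fix x y :: "'b \<Rightarrow>\<^sub>0 'k" and c :: 'k
  let ?B = "Poly_Mapping.keys x \<union> Poly_Mapping.keys y"
  show "linear_extension f (x + y) = linear_extension f x + linear_extension f y"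
    by (simp add: linear_extension_superset[of ?B] Poly_Mapping.keys_add lookup_add
        free_vs.scale_left_distrib sum.distrib)
  have "Poly_Mapping.keys (scale c x) \<subseteq> Poly_Mapping.keys x"
    by (auto simp: in_keys_iff)
  then show "linear_extension f (scale c x) = scale c (linear_extension f x)"
    by (simp add: linear_extension_superset[of "Poly_Mapping.keys x"] free_vs.scale_sum_right)
qed

lemma linear_extension_single [simp]: "linear_extension f (Poly_Mapping.single b 1) = f b"
  by (simp add: linear_extension_def)

text \<open>The tensor product of the free vector spaces on \<^typ>\<open>'b\<close> and \<^typ>\<open>'c\<close> is the free
  vector space on \<^typ>\<open>'b \<times> 'c\<close>, where \<^term>\<open>(b, c)\<close> stands for \<open>b \<otimes> c\<close>.\<close>

definition tensor :: "('b \<Rightarrow>\<^sub>0 'k) \<Rightarrow> ('c \<Rightarrow>\<^sub>0 'k) \<Rightarrow> ('b \<times> 'c \<Rightarrow>\<^sub>0 'k::field)" (infixl "\<otimes>" 70) where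
  "x \<otimes> y = (\<Sum>b \<in> Poly_Mapping.keys x. \<Sum>c \<in> Poly_Mapping.keys y.
     Poly_Mapping.single (b, c) (Poly_Mapping.lookup x b * Poly_Mapping.lookup y c))"

lemma lookup_tensor:
  "Poly_Mapping.lookup (x \<otimes> y) (b, c) = Poly_Mapping.lookup x b * Poly_Mapping.lookup y c"
proof -
  have "Poly_Mapping.lookup (x \<otimes> y) (b, c) =
    (\<Sum>b' \<in> Poly_Mapping.keys x. \<Sum>c' \<in> Poly_Mapping.keys y.
       if b' = b then if c' = c then Poly_Mapping.lookup x b' * Poly_Mapping.lookup y c' else 0
       else 0)"
    by (auto simp: tensor_def lookup_sum lookup_single when_def intro!: sum.cong)
  also have "\<dots> = (\<Sum>b' \<in> Poly_Mapping.keys x. if b' = b then \<Sum>c' \<in> Poly_Mapping.keys y.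
       if c' = c then Poly_Mapping.lookup x b' * Poly_Mapping.lookup y c' else 0 else 0)"
    by (intro sum.cong) auto
  also have "\<dots> = Poly_Mapping.lookup x b * Poly_Mapping.lookup y c"
    by (simp add: sum.delta in_keys_iff)
  finally show ?thesis .
qed

lemma tensor_single [simp]:
  "Poly_Mapping.single b 1 \<otimes> Poly_Mapping.single c 1 = Poly_Mapping.single (b, c) 1"
  by (simp add: tensor_def)

lemma linear_tensor_left: "Vector_Spaces.linear scale scale (\<lambda>x. x \<otimes> y)"
  by unfold_locales
    (rule poly_mapping_eqI, simp add: lookup_add lookup_tensor algebra_simps split_paired_all)+

lemma linear_tensor_right: "Vector_Spaces.linear scale scale (\<lambda>y. x \<otimes> y)"
  by unfold_locales
    (rule poly_mapping_eqI, simp add: lookup_add lookup_tensor algebra_simps split_paired_all)+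


section \<open>Coloured non-commutative symmetric functions\<close>

type_synonym ('a, 'k) nsym = "'a sentence \<Rightarrow>\<^sub>0 'k"

text \<open>The elements of \<^typ>\<open>('a, 'k) nsym\<close> are the finite linear combinations of sentences,
  a sentence \<^term>\<open>I\<close> being identified with the basis element \<open>H\<^sub>I\<close>.  The product
  \<open>H\<^sub>I \<cdot> H\<^sub>J = H\<^sub>K\<close> with \<^term>\<open>K = I + J\<close> is the multiplication of the monoid algebra.  For an alphabet
  \<^term>\<open>A\<close> inside the type \<^typ>\<open>'a\<close>, the Hopf algebra over \<^term>\<open>A\<close> is the subspace
  \<open>NSym A\<close>; product and coproduct are the restrictions of the ones given here.\<close>

definition H :: "'a sentence \<Rightarrow> ('a, 'k::field) nsym" where
  "H I = Poly_Mapping.single I 1"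

definition NSym :: "'a set \<Rightarrow> ('a, 'k::field) nsym set" where
  "NSym A = free_vs.span (H ` sentences A)"

lemma H_mult: "H I * H J = H (I + J)"
  by (simp add: H_def mult_single)

lemma H_empty: "H 0 = 1"
  by (simp add: H_def)

definition coproduct ::
    "('a, 'k::field) nsym \<Rightarrow> ('a sentence \<times> 'a sentence \<Rightarrow>\<^sub>0 'k)" ("\<Delta>") where
  "\<Delta> = linear_extension (\<lambda>I. \<Sum>J | J \<sqsubset> I. H (strip (I \<setminus> J)) \<otimes> H (strip J))"

lemma coproduct_H: "\<Delta> (H I) = (\<Sum>J | J \<sqsubset> I. H (strip (I \<setminus> J)) \<otimes> H (strip J))"
  by (simp add: coproduct_def H_def)

definition E :: "'a sentence \<Rightarrow> ('a, 'k::field) nsym" where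
  "E I = (\<Sum>J | J \<preceq> I. scale ((-1) ^ (sentence_size I - sentence_length J)) (H J))"

lemma E_in_NSym: "E I \<in> NSym A" if "I \<in> sentences A"
  unfolding E_def NSym_def
proof (intro free_vs.span_sum free_vs.span_scale free_vs.span_base imageI)
  fix J assume "J \<in> {J. J \<preceq> I}"
  then show "J \<in> sentences A"
    using that refines_concat[of J I] by (simp add: sentences_def del: set_concat)
qed

lemma E_empty: "E 0 = 1"
proof -
  have "{J :: 'a sentence. J \<preceq> 0} = {0}"
  proof (intro equalityI subsetI)
    fix J :: "'a sentence" assume "J \<in> {J. J \<preceq> 0}"
    then have "words J = words 0"
      by (auto simp: refines_def zero_sentence.rep_eq)
    then show "J \<in> {0}" by (simp add: words_inject)
  qed (auto simp: refines_def zero_sentence.rep_eq)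
  then show ?thesis
    by (simp add: E_def H_empty sentence_size_def sentence_length_def zero_sentence.rep_eq)
qed

end

theory Submission
  imports Defs "HOL-Library.Product_Plus"
begin

text \<open>Up to sign, \<open>w \<mapsto> E\<^sub>w\<close> is the inverse of \<open>w \<mapsto> H\<^sub>w\<close> under convolution over the
  factorizations of a word: splitting off the first block of a refinement gives
  \<open>\<Sum> (-1)\<^bsup>|u|\<^esup> H\<^sub>u \<cdot> E\<^sub>v = 0\<close>, the sum being over the factorizations \<open>w = u v\<close> of a
  nonempty word.  Apply the algebra homomorphism \<open>\<Delta>\<close>; the claimed values
  \<open>\<Sum> E\<^sub>v \<otimes> E\<^sub>u\<close> of \<open>\<Delta> E\<^sub>w\<close> satisfy the same recursion, because in
  \<open>\<Sum> (-1)\<^bsup>|p| + |q|\<^esup> H\<^sub>p E\<^sub>v \<otimes> H\<^sub>q E\<^sub>u\<close> over \<open>w = p q u v\<close> the inner sum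
  over \<open>q u\<close> vanishes unless \<open>q u\<close> is empty.  Both sides are multiplicative in the sentence,
  which reduces the general case to single words.\<close>

section \<open>Factorizations of words\<close>

text \<open>Pairs rather than cut positions, so that regrouping an iterated factorization is a plain
  bijection of index sets.\<close>

definition splits :: "'a list \<Rightarrow> ('a list \<times> 'a list) set" where
  "splits w = {(u, v). u @ v = w}"

lemma splits_eq_image: "splits w = (\<lambda>j. (take j w, drop j w)) ` {0..length w}"
proof (intro equalityI subsetI)
  fix x assume "x \<in> splits w"
  then obtain u v where "x = (u, v)" "u @ v = w" by (auto simp: splits_def)
  then show "x \<in> (\<lambda>j. (take j w, drop j w)) ` {0..length w}"
    by (intro image_eqI[of _ _ "length u"]) auto
qed (auto simp: splits_def)

lemma finite_splits [simp]: "finite (splits w)"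
  by (simp add: splits_eq_image)

lemma splits_Nil [simp]: "splits [] = {([], [])}"
  by (auto simp: splits_def)

lemma Nil_in_splits [simp]: "([], w) \<in> splits w"
  by (simp add: splits_def)

lemma sum_splits:
  "(\<Sum>(u, v) \<in> splits w. f u v) = (\<Sum>j = 0..length w. f (take j w) (drop j w))"
proof -
  have "inj_on (\<lambda>j. (take j w, drop j w)) {0..length w}"
  proof (rule inj_onI)
    fix i j assume "i \<in> {0..length w}" "j \<in> {0..length w}"
      "(take i w, drop i w) = (take j w, drop j w)"
    then have "length (take i w) = length (take j w)" by simp
    with \<open>i \<in> _\<close> \<open>j \<in> _\<close> show "i = j" by simp
  qed
  then show ?thesis by (simp add: splits_eq_image sum.reindex)
qed

text \<open>Coassociativity of deconcatenation: both sides run over the triples with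
  \<open>p @ q @ y = w\<close>.\<close>

lemma sum_splits_assoc:
  "(\<Sum>(x, y) \<in> splits w. \<Sum>(p, q) \<in> splits x. f p q y) =
   (\<Sum>(p, z) \<in> splits w. \<Sum>(q, y) \<in> splits z. f p q y)"
proof -
  have "(\<Sum>(x, y) \<in> splits w. \<Sum>(p, q) \<in> splits x. f p q y) =
      (\<Sum>((x, y), (p, q)) \<in> (SIGMA s:splits w. splits (fst s)). f p q y)"
    by (subst sum.Sigma[symmetric]) (auto simp: split_def)
  also have "\<dots> = (\<Sum>((p, z), (q, y)) \<in> (SIGMA s:splits w. splits (snd s)). f p q y)"
    by (rule sum.reindex_bij_witness[where i = "\<lambda>((p, z), (q, y)). ((p @ q, y), (p, q))"
          and j = "\<lambda>((x, y), (p, q)). ((p, q @ y), (q, y))"])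
      (auto simp: splits_def)
  also have "\<dots> = (\<Sum>(p, z) \<in> splits w. \<Sum>(q, y) \<in> splits z. f p q y)"
    by (subst sum.Sigma[symmetric]) (auto simp: split_def)
  finally show ?thesis .
qed


section \<open>Sentences\<close>

lemma words_strip: "words (strip J) = filter (\<lambda>w. w \<noteq> []) J"
  by (rule strip.rep_eq)

lemma words_strip_single: "w \<noteq> [] \<Longrightarrow> words (strip [w]) = [w]"
  by (simp add: words_strip)

lemma words_plus: "words (I + J) = words I @ words J"
  by (rule plus_sentence.rep_eq)

lemma words_zero [simp]: "words 0 = []"
  by (rule zero_sentence.rep_eq)

lemma strip_append: "strip (J @ K) = strip J + strip K"
  by (simp add: words_inject[symmetric] words_strip words_plus)

lemma strip_Nil [simp]: "strip [] = 0"
  by (simp add: words_inject[symmetric] words_strip)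

lemma strip_empty_word [simp]: "strip [[]] = 0"
  by (simp add: words_inject[symmetric] words_strip)

lemma strip_words: "strip (words I) = I"
  using words[of I] by (auto simp: words_inject[symmetric] words_strip filter_id_conv)

text \<open>The step also ranges over empty \<open>w\<close>, where \<open>strip [w]\<close> is
  \<open>0\<close>; the facts about single words below are stated so as to cover this case.\<close>

lemma sentence_induct [case_names zero plus]:
  assumes zero: "P 0" and plus: "\<And>w I. P I \<Longrightarrow> P (strip [w] + I)"
  shows "P I"
proof -
  have "P (strip ws)" for ws
  proof (induction ws)
    case (Cons w ws)
    then show ?case using plus strip_append[of "[w]" ws] by simp
  qed (simp add: zero)
  from this[of "words I"] show ?thesis by (simp add: strip_words)
qed


section \<open>Weak subsentences\<close>

lemma weak_sub_zero_iff [simp]: "J \<sqsubset> 0 \<longleftrightarrow> J = []"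
  by (auto simp: weak_sub_def is_complement_def)

lemma complement_zero [simp]: "0 \<setminus> [] = []"
  by (rule complement_eqI) (simp add: is_complement_def)

lemma is_complement_append:
  assumes "is_complement I J U" "is_complement I' J' U'"
  shows "is_complement (I + I') (J @ J') (U @ U')"
  using assms by (auto simp: is_complement_def words_plus nth_append)

lemma is_complement_plusD:
  assumes "is_complement (I + I') J U"
  defines "n \<equiv> length (words I)"
  shows "is_complement I (take n J) (take n U)" "is_complement I' (drop n J) (drop n U)"
proof -
  have "\<forall>i < n + length (words I'). (words I @ words I') ! i = U ! i @ J ! i"
    and l: "length J = n + length (words I')" "length U = n + length (words I')"
    using assms by (auto simp: is_complement_def words_plus)
  then have "words I ! i = U ! i @ J ! i" if "i < n" for i
    using that by (auto simp: nth_append n_def split: if_splits dest!: spec[of _ i])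
  then show "is_complement I (take n J) (take n U)"
    using l by (auto simp: is_complement_def n_def[symmetric])
  have "words I' ! i = U ! (n + i) @ J ! (n + i)" if "i < length (words I')" for i
    using \<open>\<forall>i < _. _\<close> that by (auto simp: nth_append n_def dest!: spec[of _ "n + i"])
  then show "is_complement I' (drop n J) (drop n U)"
    using l by (auto simp: is_complement_def n_def[symmetric])
qed

text \<open>A weak subsentence of \<open>I + I'\<close> is uniquely one of \<open>I\<close> followed
  by one of \<open>I'\<close>, and \<open>strip\<close> respects concatenation. The function
  \<open>\<phi>\<close> is left general because both the coproduct of \<open>H\<close> and the
  claimed coproduct of \<open>E\<close> are sums of this shape.\<close>

lemma sum_weak_sub_plus:
  fixes \<phi> :: "'a sentence \<Rightarrow> 'a sentence \<Rightarrow> 'r::semiring_0"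
  assumes \<phi>: "\<And>I J K L. \<phi> (I + J) (K + L) = \<phi> I K * \<phi> J L"
  shows "(\<Sum>J | J \<sqsubset> I + I'. \<phi> (strip ((I + I') \<setminus> J)) (strip J)) =
    (\<Sum>J | J \<sqsubset> I. \<phi> (strip (I \<setminus> J)) (strip J)) *
    (\<Sum>J | J \<sqsubset> I'. \<phi> (strip (I' \<setminus> J)) (strip J))"
proof -
  let ?n = "length (words I)"
  have "(\<Sum>J | J \<sqsubset> I. \<phi> (strip (I \<setminus> J)) (strip J)) *
      (\<Sum>J | J \<sqsubset> I'. \<phi> (strip (I' \<setminus> J)) (strip J)) =
      (\<Sum>(J, J') \<in> {J. J \<sqsubset> I} \<times> {J. J \<sqsubset> I'}.
        \<phi> (strip (I \<setminus> J)) (strip J) * \<phi> (strip (I' \<setminus> J')) (strip J'))"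
    by (simp add: sum_product sum.cartesian_product)
  also have "\<dots> = (\<Sum>J | J \<sqsubset> I + I'. \<phi> (strip ((I + I') \<setminus> J)) (strip J))"
  proof (rule sum.reindex_bij_witness[where i = "\<lambda>J. (take ?n J, drop ?n J)"
        and j = "\<lambda>(J, J'). J @ J'"])
    fix x assume x: "x \<in> {J. J \<sqsubset> I} \<times> {J. J \<sqsubset> I'}"
    obtain J J' where [simp]: "x = (J, J')" by (cases x)
    from x have c: "is_complement I J (I \<setminus> J)" "is_complement I' J' (I' \<setminus> J')"
      by (auto intro: is_complement_complement)
    \<comment> \<open>Knowing this length is what makes cutting after \<open>?n\<close> entries undo
      the concatenation.\<close>
    then have l: "length J = ?n" by (simp add: is_complement_def)
    note c' = is_complement_append[OF c]
    show "(\<lambda>J. (take ?n J, drop ?n J)) (case x of (J, J') \<Rightarrow> J @ J') = x"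
      using l by simp
    show "(case x of (J, J') \<Rightarrow> J @ J') \<in> {J. J \<sqsubset> I + I'}"
      using c' by (auto simp: weak_sub_def)
    show "\<phi> (strip ((I + I') \<setminus> (case x of (J, J') \<Rightarrow> J @ J'))) (strip (case x of (J, J') \<Rightarrow> J @ J')) =
        (case x of (J, J') \<Rightarrow> \<phi> (strip (I \<setminus> J)) (strip J) * \<phi> (strip (I' \<setminus> J')) (strip J'))"
      by (simp add: complement_eqI[OF c'] strip_append \<phi>)
  next
    fix J assume "J \<in> {J. J \<sqsubset> I + I'}"
    then show "(take ?n J, drop ?n J) \<in> {J. J \<sqsubset> I} \<times> {J. J \<sqsubset> I'}"
      by (auto simp: weak_sub_def dest: is_complement_plusD)
  qed auto
  finally show ?thesis by simp
qed

text \<open>For nonempty \<open>w\<close> the weak subsentences are the lists \<open>[v]\<close>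
  with \<open>v\<close> a suffix of \<open>w\<close>. For empty \<open>w\<close> both sums reduce to
  \<open>\<phi> 0 0\<close>.\<close>

lemma sum_weak_sub_word:
  "(\<Sum>J | J \<sqsubset> strip [w]. \<phi> (strip (strip [w] \<setminus> J)) (strip J)) =
   (\<Sum>(u, v) \<in> splits w. \<phi> (strip [u]) (strip [v]))"
proof (cases "w = []")
  case False
  have c: "is_complement (strip [w]) J U \<longleftrightarrow> (\<exists>u v. J = [v] \<and> U = [u] \<and> u @ v = w)" for J U
    using False by (auto simp: is_complement_def words_strip_single length_Suc_conv)
  have eq: "strip [u @ v] \<setminus> [v] = [u]" if "u @ v = w" for u v
    using that c by (intro complement_eqI) auto
  show ?thesis
  proof (rule sum.reindex_bij_witness[where i = "\<lambda>(u, v). [v]"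
        and j = "\<lambda>J. (hd (strip [w] \<setminus> J), hd J)"])
  qed (auto simp: weak_sub_def c splits_def eq)
qed simp


section \<open>Multiplicativity\<close>

lemma single_induct [case_names single plus]:
  assumes "\<And>b c. P (Poly_Mapping.single b c)" "\<And>x y. P x \<Longrightarrow> P y \<Longrightarrow> P (x + y)"
  shows "P (x :: 'b \<Rightarrow>\<^sub>0 'k::comm_monoid_add)"
proof -
  have "P (\<Sum>b \<in> B. Poly_Mapping.single b (Poly_Mapping.lookup x b))" if "finite B" for B
    using that
  proof induction
    case empty
    \<comment> \<open>A monomial with coefficient \<open>0\<close> is the zero element, whatever its
      index.\<close>
    then show ?case using assms(1)[of undefined 0] by simp
  qed (simp add: assms)
  moreover have "(\<Sum>b \<in> Poly_Mapping.keys x. Poly_Mapping.single b (Poly_Mapping.lookup x b)) = x"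
    by (rule poly_mapping_eqI) (auto simp: lookup_sum lookup_single when_def in_keys_iff)
  ultimately show ?thesis using finite_keys by metis
qed

section \<open>The tensor product of monoid algebras\<close>

lemma tensor_add_left: "(x + x') \<otimes> y = x \<otimes> y + x' \<otimes> y"
  by (rule module_hom.add [OF linear_tensor_left [unfolded linear_iff_module_hom]])

lemma tensor_add_right: "x \<otimes> (y + y') = x \<otimes> y + x \<otimes> y'"
  by (rule module_hom.add [OF linear_tensor_right [unfolded linear_iff_module_hom]])

lemma tensor_zero_left [simp]: "0 \<otimes> y = 0"
  and tensor_zero_right [simp]: "x \<otimes> 0 = 0"
  by (simp_all add: tensor_def)

lemma tensor_single_single:
  "Poly_Mapping.single b s \<otimes> Poly_Mapping.single c t = Poly_Mapping.single (b, c) (s * t)"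
  by (rule poly_mapping_eqI) (auto simp: lookup_tensor lookup_single when_def split_paired_all)

text \<open>Both sides are additive in each of the four factors, and on monomials the product adds
  indices componentwise in the product monoid.\<close>

lemma tensor_mult:
  fixes x x' :: "'b::monoid_add \<Rightarrow>\<^sub>0 'k::field" and y y' :: "'c::monoid_add \<Rightarrow>\<^sub>0 'k"
  shows "(x \<otimes> y) * (x' \<otimes> y') = (x * x') \<otimes> (y * y')"
proof (induction x rule: single_induct)
  case (single b s)
  show ?case
  proof (induction y rule: single_induct)
    case (single c t)
    show ?case
    proof (induction x' rule: single_induct)
      case (single b' s')
      show ?case
        by (induction y' rule: single_induct)
          (simp_all add: tensor_single_single mult_single tensor_add_right algebra_simps)
    qed (simp add: tensor_add_left algebra_simps)
  qed (simp add: tensor_add_right algebra_simps)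
qed (simp add: tensor_add_left algebra_simps)

lemma tensor_sum_left: "(\<Sum>i \<in> B. f i) \<otimes> y = (\<Sum>i \<in> B. f i \<otimes> y)"
  by (rule module_hom.sum [OF linear_tensor_left [unfolded linear_iff_module_hom]])

lemma tensor_sum_right: "x \<otimes> (\<Sum>i \<in> B. f i) = (\<Sum>i \<in> B. x \<otimes> f i)"
  by (rule module_hom.sum [OF linear_tensor_right [unfolded linear_iff_module_hom]])

section \<open>The coproduct as an algebra homomorphism\<close>

lemma module_hom_coproduct: "module_hom scale scale (\<Delta> :: ('a, 'k::field) nsym \<Rightarrow> _)"
  unfolding coproduct_def
  by (rule linear_linear_extension [unfolded linear_iff_module_hom])

lemmas coproduct_add = module_hom.add [OF module_hom_coproduct]
  and coproduct_scale = module_hom.scale [OF module_hom_coproduct]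
  and coproduct_sum = module_hom.sum [OF module_hom_coproduct]

lemma scale_eq_mult: "scale c x = Poly_Mapping.single 0 c * x"
  for x :: "'b::monoid_add \<Rightarrow>\<^sub>0 'k::field"
proof (induction x rule: single_induct)
  case (single b s)
  then show ?case
    by (auto simp: mult_single lookup_single when_def intro!: poly_mapping_eqI)
qed (simp add: free_vs.scale_right_distrib algebra_simps)

text \<open>Scalars are central although the product of sentences is not commutative.\<close>

lemma mult_scale_right: "x * scale c y = scale c (x * y)"
  for x :: "'b::monoid_add \<Rightarrow>\<^sub>0 'k::field"
proof (induction x rule: single_induct)
  case (single b s)
  show ?case
    by (induction y rule: single_induct)
      (simp_all add: scale_eq_mult mult_single algebra_simps)
qed (simp add: free_vs.scale_right_distrib algebra_simps)

lemma mult_scale_left: "scale c x * y = scale c (x * y)"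
  for x :: "'b::monoid_add \<Rightarrow>\<^sub>0 'k::field"
  by (simp add: scale_eq_mult mult.assoc)

lemma single_eq_scale_H: "Poly_Mapping.single I c = scale c (H I)"
  by (simp add: scale_eq_mult H_def mult_single)

lemma coproduct_H_plus: "\<Delta> (H (I + J)) = \<Delta> (H I) * (\<Delta> (H J) :: _ \<Rightarrow>\<^sub>0 'k::field)"
  unfolding coproduct_H
  by (rule sum_weak_sub_plus) (simp add: H_mult tensor_mult)

lemma coproduct_mult: "\<Delta> (x * y) = \<Delta> x * \<Delta> y"
  for x :: "('a, 'k::field) nsym"
proof (induction x rule: single_induct)
  case (single I s)
  show ?case
  proof (induction y rule: single_induct)
    case (single J t)
    show ?case
      by (simp add: single_eq_scale_H mult_scale_left mult_scale_right coproduct_scale H_mult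
          coproduct_H_plus)
  qed (simp add: coproduct_add algebra_simps)
qed (simp add: coproduct_add algebra_simps)

lemma one_tensor_one:
  "(1 :: 'b::monoid_add \<Rightarrow>\<^sub>0 'k::field) \<otimes> (1 :: 'c::monoid_add \<Rightarrow>\<^sub>0 'k) = 1"
proof -
  have "Poly_Mapping.single (0 :: 'b) (1 :: 'k) \<otimes> Poly_Mapping.single (0 :: 'c) 1 = Poly_Mapping.single 0 1"
    unfolding zero_prod_def by (rule tensor_single)
  then show ?thesis by simp
qed

lemma coproduct_one: "\<Delta> (1 :: ('a, 'k::field) nsym) = 1"
  using coproduct_H[of "0 :: 'a sentence", where 'b = 'k] by (simp add: H_empty one_tensor_one)

lemma coproduct_H_word:
  "\<Delta> (H (strip [w])) = (\<Sum>(u, v) \<in> splits w. H (strip [u]) \<otimes> H (strip [v]))"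
  unfolding coproduct_H by (rule sum_weak_sub_word)


section \<open>Elementary functions\<close>

text \<open>A refinement has at most as many words as \<open>I\<close> has letters, so the truncated
  difference in the exponent has the parity of the sum. With the sum, signs multiply under
  concatenation.\<close>

lemma E_altdef:
  "E I = (\<Sum>J | J \<preceq> I. Poly_Mapping.single J ((-1) ^ (sentence_size I + sentence_length J)))"
  unfolding E_def
proof (intro sum.cong refl)
  fix J assume "J \<in> {J. J \<preceq> I}"
  then have "sentence_length J \<le> sentence_size I"
    using refines_concat[of J I] sentence_length_le_size[of J]
    by (simp add: sentence_size_def)
  then obtain d where "sentence_size I = sentence_length J + d"
    using le_Suc_ex by blast
  then show "scale ((-1) ^ (sentence_size I - sentence_length J)) (H J) =
      Poly_Mapping.single J ((-1) ^ (sentence_size I + sentence_length J))"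
    by (simp add: single_eq_scale_H power_add mult.commute[of "(-1) ^ d"])
qed

text \<open>One of the two prefixes extends the other by nonempty words that together spell the
  empty word, hence by none.\<close>

lemma concat_eq_append_imp_eq:
  assumes "xs @ ys = xs' @ ys'" "concat xs = concat xs'" "[] \<notin> set (xs @ ys)"
  shows "xs = xs'"
proof -
  from assms(1) obtain us where "xs = xs' @ us \<or> xs @ us = xs'"
    by (auto simp: append_eq_append_conv2)
  with assms have "concat us = []" "[] \<notin> set us"
    by (auto simp: append_eq_append_conv2)
  then have "us = []" by (cases us) auto
  with \<open>xs = xs' @ us \<or> xs @ us = xs'\<close> show ?thesis by auto
qed

text \<open>The blocks witnessing a refinement of \<open>I + J\<close> divide into those forming
  words of \<open>I\<close> and those forming words of \<open>J\<close>.\<close>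

lemma refines_plus: "{K. K \<preceq> I + J} = (\<lambda>(K, L). K + L) ` ({K. K \<preceq> I} \<times> {L. L \<preceq> J})"
proof (intro equalityI subsetI)
  fix M assume "M \<in> {K. K \<preceq> I + J}"
  then obtain G where G: "concat G = words M" "map concat G = words I @ words J"
    by (auto simp: refines_def words_plus)
  then obtain G1 G2 where [simp]: "G = G1 @ G2" "map concat G1 = words I" "map concat G2 = words J"
    by (auto simp: map_eq_append_conv)
  have "[] \<notin> set (concat G1)" "[] \<notin> set (concat G2)"
    using words[of M] G(1)[symmetric] by auto
  then have w: "words (Sentence (concat G1)) = concat G1" "words (Sentence (concat G2)) = concat G2"
    by (simp_all add: Sentence_inverse)
  have "M = Sentence (concat G1) + Sentence (concat G2)"
    using G(1) by (simp add: words_inject[symmetric] words_plus w)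
  moreover have "Sentence (concat G1) \<preceq> I" "Sentence (concat G2) \<preceq> J"
    unfolding refines_def w by force+
  ultimately show "M \<in> (\<lambda>(K, L). K + L) ` ({K. K \<preceq> I} \<times> {L. L \<preceq> J})" by auto
next
  fix M assume "M \<in> (\<lambda>(K, L). K + L) ` ({K. K \<preceq> I} \<times> {L. L \<preceq> J})"
  then obtain K L G1 G2 where "M = K + L" "concat G1 = words K" "map concat G1 = words I"
    "concat G2 = words L" "map concat G2 = words J"
    by (auto simp: refines_def)
  then show "M \<in> {K. K \<preceq> I + J}"
    by (auto simp: refines_def words_plus intro!: exI[of _ "G1 @ G2"])
qed

text \<open>The boundary in \<open>K + L\<close> is recovered from the letters, since
  \<open>K\<close> spells the same letters as \<open>I\<close>.\<close>

lemma inj_on_plus_refines: "inj_on (\<lambda>(K, L). K + L) ({K. K \<preceq> I} \<times> {L. L \<preceq> J})"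
proof (rule inj_onI, clarify)
  fix K L K' L' assume *: "K \<preceq> I" "K' \<preceq> I" "K + L = K' + L'"
  then have e: "words K @ words L = words K' @ words L'" by (simp add: words_plus[symmetric])
  have "words K = words K'"
  proof (rule concat_eq_append_imp_eq[OF e])
    show "concat (words K) = concat (words K')"
      using refines_concat[OF *(1)] refines_concat[OF *(2)] by simp
    show "[] \<notin> set (words K @ words L)"
      using words[of K] words[of L] by simp
  qed
  then show "K = K' \<and> L = L'" using e by (auto simp: words_inject)
qed

lemma sentence_size_plus: "sentence_size (I + J) = sentence_size I + sentence_size J"
  by (simp add: sentence_size_def words_plus)

lemma sentence_length_plus: "sentence_length (I + J) = sentence_length I + sentence_length J"
  by (simp add: sentence_length_def words_plus)

lemma E_plus: "E (I + J) = E I * (E J :: ('a, 'k::field) nsym)"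
proof -
  let ?t = "\<lambda>I K. Poly_Mapping.single K ((-1) ^ (sentence_size I + sentence_length K)) :: ('a, 'k) nsym"
  have "?t I K * ?t J L = ?t (I + J) (K + L)" for K L
    by (simp add: mult_single sentence_size_plus sentence_length_plus power_add mult_ac)
  then have "E I * E J = (\<Sum>(K, L) \<in> {K. K \<preceq> I} \<times> {L. L \<preceq> J}. ?t (I + J) (K + L))"
    by (simp add: E_altdef sum_product sum.cartesian_product)
  also have "\<dots> = E (I + J)"
    unfolding E_altdef refines_plus
    by (subst sum.reindex[OF inj_on_plus_refines]) (auto intro: sum.cong)
  finally show ?thesis by simp
qed

lemma refines_word: "J \<preceq> strip [w] \<longleftrightarrow> concat (words J) = w"
proof
  assume "J \<preceq> strip [w]"
  then show "concat (words J) = w"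
    using refines_concat[of J "strip [w]"] by (cases "w = []") (auto simp: words_strip)
next
  assume w: "concat (words J) = w"
  show "J \<preceq> strip [w]"
  proof (cases "w = []")
    case True
    then have "words J = []"
      using w words[of J] by (cases "words J") auto
    then show ?thesis using True by (auto simp: refines_def)
  next
    case False
    then show ?thesis
      using w unfolding refines_def by (intro exI[of _ "[words J]"]) (simp add: words_strip)
  qed
qed

lemma E_word: "E (strip [w]) =
    (\<Sum>J | concat (words J) = w. Poly_Mapping.single J ((-1) ^ (length w + sentence_length J)))"
proof -
  have "sentence_size (strip [w]) = length w"
    by (cases "w = []") (simp_all add: sentence_size_def words_strip)
  then show ?thesis by (simp add: E_altdef refines_word)
qed

text \<open>Turns a sign in the algebra into a coefficient, so that it multiplies with
  monomials.\<close>

lemma minus_one_power_single: "(-1) ^ n = (Poly_Mapping.single 0 ((-1) ^ n) :: _ \<Rightarrow>\<^sub>0 'k::field)"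
  by (cases "even n") (simp_all add: single_uminus)

text \<open>Each refinement of \<open>w\<close> is uniquely a first word \<open>u\<close> followed
  by a sentence \<open>K\<close> spelling \<open>v\<close>. The omitted pair \<open>([], w)\<close>
  is the only one without a first word.\<close>

lemma E_word_rec:
  assumes "w \<noteq> []"
  shows "(\<Sum>(u, v) \<in> splits w - {([], w)}. (-1) ^ length u * H (strip [u]) * E (strip [v])) =
    - (E (strip [w]) :: ('a, 'k::field) nsym)"
proof -
  let ?S = "splits w - {([], w)}"
  let ?C = "\<lambda>w. {J. concat (words J) = w}"
  let ?t = "\<lambda>w J. Poly_Mapping.single J ((-1) ^ (length w + sentence_length J)) :: ('a, 'k) nsym"
  have fin: "finite (?C v)" for v :: "'a list"
    using finite_refines[of "strip [v]"] by (simp add: refines_word)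
  have nonempty: "u \<noteq> []" if "(u, v) \<in> ?S" for u v
    using that by (auto simp: splits_def)
  have t: "(-1) ^ length u * H (strip [u]) * ?t v K = - ?t w (strip [u] + K)"
    if "(u, v) \<in> ?S" for u v K
  proof -
    \<comment> \<open>Prepending the nonempty \<open>u\<close> adds exactly one word, which is the
      source of the minus sign.\<close>
    have "sentence_length (strip [u]) = 1"
      using nonempty[OF that] by (simp add: sentence_length_def words_strip)
    moreover have "length w = length u + length v" using that by (auto simp: splits_def)
    ultimately show ?thesis
      by (simp add: H_def mult_single minus_one_power_single[of "length u"] sentence_length_plus
          power_add mult_ac flip: single_uminus)
  qed
  have "(\<Sum>(u, v) \<in> ?S. (-1) ^ length u * H (strip [u]) * E (strip [v])) =
      (\<Sum>(u, v) \<in> ?S. - (\<Sum>K \<in> ?C v. ?t w (strip [u] + K)))"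
  proof -
    have "(-1) ^ length u * H (strip [u]) * E (strip [v]) = - (\<Sum>K \<in> ?C v. ?t w (strip [u] + K))"
      if "(u, v) \<in> ?S" for u v
      unfolding E_word sum_distrib_left sum_negf[symmetric] by (intro sum.cong refl t that)
    then show ?thesis by (intro sum.cong refl) auto
  qed
  also have "\<dots> = - (\<Sum>(u, v) \<in> ?S. \<Sum>K \<in> ?C v. ?t w (strip [u] + K))"
    by (simp add: split_def sum_negf)
  also have "(\<Sum>(u, v) \<in> ?S. \<Sum>K \<in> ?C v. ?t w (strip [u] + K)) =
      (\<Sum>(s, K) \<in> (SIGMA s:?S. ?C (snd s)). ?t w (strip [fst s] + K))"
    by (subst sum.Sigma[symmetric]) (auto simp: fin split_def)
  also have "\<dots> = (\<Sum>J \<in> ?C w. ?t w J)"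
  proof (rule sum.reindex_bij_witness[where
        i = "\<lambda>J. ((hd (words J), concat (tl (words J))), strip (tl (words J)))"
        and j = "\<lambda>(s, K). strip [fst s] + K"])
    fix x assume "x \<in> (SIGMA s:?S. ?C (snd s))"
    then obtain s K where sK: "x = (s, K)" "s \<in> ?S" "K \<in> ?C (snd s)"
      by (rule SigmaE)
    obtain u v where "s = (u, v)" by (cases s)
    with sK have x: "x = ((u, v), K)" and uv: "(u, v) \<in> ?S" and K: "concat (words K) = v"
      by simp_all
    have wK: "words (strip [u] + K) = u # words K"
      using nonempty[OF uv] by (simp add: words_plus words_strip)
    show "((hd (words (case x of (s, K) \<Rightarrow> strip [fst s] + K)),
        concat (tl (words (case x of (s, K) \<Rightarrow> strip [fst s] + K)))),
        strip (tl (words (case x of (s, K) \<Rightarrow> strip [fst s] + K)))) = x"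
      by (simp add: x wK K strip_words)
    show "(case x of (s, K) \<Rightarrow> strip [fst s] + K) \<in> ?C w"
      using uv K by (simp add: x wK splits_def)
  next
    fix J assume J: "J \<in> ?C w"
    \<comment> \<open>As \<open>w\<close> is nonempty, \<open>J\<close> has a first word; that word
      is nonempty, so the resulting pair is not \<open>([], w)\<close>.\<close>
    with assms obtain u ws where uws: "words J = u # ws" by (cases "words J") auto
    with words[of J] have ne: "u \<noteq> []" "[] \<notin> set ws" by auto
    then have s: "words (strip ws) = ws" by (auto simp: words_strip filter_id_conv)
    show "(case ((hd (words J), concat (tl (words J))), strip (tl (words J))) of
        (s, K) \<Rightarrow> strip [fst s] + K) = J"
      using uws ne by (simp add: words_inject[symmetric] words_plus words_strip_single s)
    show "((hd (words J), concat (tl (words J))), strip (tl (words J))) \<in> (SIGMA s:?S. ?C (snd s))"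
      using J uws ne by (auto simp: splits_def s)
  qed auto
  finally show ?thesis by (simp add: E_word)
qed

text \<open>The convolution identity: for nonempty \<open>w\<close> the term with
  \<open>u = []\<close> is \<open>E (strip [w])\<close>, which cancels the recursion.\<close>

lemma sum_H_E_word:
  "(\<Sum>(u, v) \<in> splits w. (-1) ^ length u * H (strip [u]) * E (strip [v])) =
    (if w = [] then 1 else 0 :: ('a, 'k::field) nsym)"
proof (cases "w = []")
  case False
  then show ?thesis
    using E_word_rec[OF False, where 'k = 'k]
    by (simp add: sum.remove[of _ "([], w)"] H_empty)
qed (simp add: H_empty E_empty)


section \<open>The coproduct of the elementary functions\<close>

text \<open>Distributes the sign of a factored word over the two tensor factors.\<close>

lemma minus_one_power_mult_tensor:
  "(-1) ^ (m + n) * (x \<otimes> y) = ((-1) ^ m * x) \<otimes> ((-1) ^ n * y)"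
  for x :: "'b::monoid_add \<Rightarrow>\<^sub>0 'k::field" and y :: "'c::monoid_add \<Rightarrow>\<^sub>0 'k"
proof -
  have "(- x) \<otimes> y = - (x \<otimes> y)" "x \<otimes> (- y) = - (x \<otimes> y)" for x :: "'b \<Rightarrow>\<^sub>0 'k" and y :: "'c \<Rightarrow>\<^sub>0 'k"
    by (rule poly_mapping_eqI, simp add: lookup_tensor split_paired_all)+
  then show ?thesis
    by (cases "even m"; cases "even n") simp_all
qed

lemma coproduct_E_word:
  "\<Delta> (E (strip [w]) :: ('a, 'k::field) nsym) = (\<Sum>(u, v) \<in> splits w. E (strip [v]) \<otimes> E (strip [u]))"
proof (induction "length w" arbitrary: w rule: less_induct)
  case less
  let ?h = "\<lambda>u. H (strip [u]) :: ('a, 'k) nsym" and ?e = "\<lambda>u. E (strip [u]) :: ('a, 'k) nsym"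
  let ?F = "\<lambda>w. \<Sum>(u, v) \<in> splits w. ?e v \<otimes> ?e u"
  show ?case
  proof (cases "w = []")
    case True
    then show ?thesis by (simp add: E_empty coproduct_one one_tensor_one)
  next
    case False
    let ?S = "splits w - {([], w)}"
    have Delta_minus_one_power: "\<Delta> ((-1) ^ n :: ('a, 'k) nsym) = (-1) ^ n" for n
      using coproduct_scale[of "-1" "1 :: ('a, 'k) nsym"]
      by (cases "even n") (simp_all add: coproduct_one)
    have "(\<Sum>(x, y) \<in> splits w. (-1) ^ length x * \<Delta> (?h x) * ?F y) =
      (\<Sum>(x, y) \<in> splits w. \<Sum>(p, q) \<in> splits x. \<Sum>(u, v) \<in> splits y.
        ((-1) ^ length p * ?h p * ?e v) \<otimes> ((-1) ^ length q * ?h q * ?e u))"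
    proof (intro sum.cong refl, clarify)
      fix x y
      have t: "(-1) ^ length x * (?h p \<otimes> ?h q) * (?e v \<otimes> ?e u) =
          ((-1) ^ length p * ?h p * ?e v) \<otimes> ((-1) ^ length q * ?h q * ?e u)"
        if "(p, q) \<in> splits x" for p q u v
      proof -
        have "length x = length p + length q" using that by (auto simp: splits_def)
        then show ?thesis by (simp only: minus_one_power_mult_tensor tensor_mult)
      qed
      have "(-1) ^ length x * \<Delta> (?h x) * ?F y = (\<Sum>(p, q) \<in> splits x. \<Sum>(u, v) \<in> splits y.
          (-1) ^ length x * (?h p \<otimes> ?h q) * (?e v \<otimes> ?e u))"
        by (simp only: coproduct_H_word mult.assoc sum_distrib_left[of "(-1) ^ length x"]
            sum_product split_def)
      also have "\<dots> = (\<Sum>(p, q) \<in> splits x. \<Sum>(u, v) \<in> splits y.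
          ((-1) ^ length p * ?h p * ?e v) \<otimes> ((-1) ^ length q * ?h q * ?e u))"
        by (intro sum.cong refl) (auto simp: t)
      finally show "(-1) ^ length x * \<Delta> (?h x) * ?F y = (\<Sum>(p, q) \<in> splits x. \<Sum>(u, v) \<in> splits y.
        ((-1) ^ length p * ?h p * ?e v) \<otimes> ((-1) ^ length q * ?h q * ?e u))" .
    qed
    \<comment> \<open>Two regroupings follow: \<open>(p q) y\<close> becomes \<open>p (q y)\<close>,
      then \<open>q (u v)\<close> becomes \<open>(q u) v\<close>, which brings \<open>q\<close> and
      \<open>u\<close> together in the right tensor factor.\<close>
    also have "\<dots> = (\<Sum>(p, z) \<in> splits w. \<Sum>(q, y) \<in> splits z. \<Sum>(u, v) \<in> splits y.
        ((-1) ^ length p * ?h p * ?e v) \<otimes> ((-1) ^ length q * ?h q * ?e u))"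
      by (rule sum_splits_assoc)
    also have "\<dots> = (\<Sum>(p, z) \<in> splits w. \<Sum>(m, v) \<in> splits z. \<Sum>(q, u) \<in> splits m.
        ((-1) ^ length p * ?h p * ?e v) \<otimes> ((-1) ^ length q * ?h q * ?e u))"
      by (simp only: sum_splits_assoc[symmetric])
    also have "\<dots> = (\<Sum>(p, z) \<in> splits w. \<Sum>(m, v) \<in> splits z.
        ((-1) ^ length p * ?h p * ?e v) \<otimes> (if m = [] then 1 else 0))"
      by (simp only: sum_H_E_word[symmetric] tensor_sum_right split_def)
    \<comment> \<open>Only \<open>m = []\<close> survives, and then \<open>v\<close> is all of
      \<open>z\<close>.\<close>
    also have "\<dots> = (\<Sum>(p, z) \<in> splits w. ((-1) ^ length p * ?h p * ?e z) \<otimes> 1)"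
    proof (intro sum.cong refl, clarify)
      fix p z
      have "(\<Sum>(m, v) \<in> splits z. ((-1) ^ length p * ?h p * ?e v) \<otimes> (if m = [] then 1 else 0)) =
        (\<Sum>(m, v) \<in> {([] :: 'a list, z)}.
          ((-1) ^ length p * ?h p * ?e v) \<otimes> (if m = [] then 1 else 0 :: ('a, 'k) nsym))"
      proof (rule sum.mono_neutral_right)
        have Nil: "v = z" if "([], v) \<in> splits z" for v
          using that by (simp add: splits_def)
        show "\<forall>s \<in> splits z - {([], z)}. (case s of (m, v) \<Rightarrow>
            ((-1) ^ length p * ?h p * ?e v) \<otimes> (if m = [] then 1 else 0 :: ('a, 'k) nsym)) = 0"
          by (auto dest: Nil split: if_splits)
      qed simp_all
      then show "(\<Sum>(m, v) \<in> splits z. ((-1) ^ length p * ?h p * ?e v) \<otimes> (if m = [] then 1 else 0)) =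
        ((-1) ^ length p * ?h p * ?e z) \<otimes> (1 :: ('a, 'k) nsym)" by simp
    qed
    \<comment> \<open>The convolution identity a second time, now in the left factor over
      \<open>w = p z\<close>.\<close>
    also have "\<dots> = 0"
      using sum_H_E_word[of w, where 'k = 'k] False
      by (simp add: tensor_sum_left[symmetric] split_def)
    finally have F: "(\<Sum>(x, y) \<in> splits w. (-1) ^ length x * \<Delta> (?h x) * ?F y) = 0" .
    have "(\<Sum>(x, y) \<in> splits w. (-1) ^ length x * \<Delta> (?h x) * \<Delta> (?e y)) =
      \<Delta> (\<Sum>(x, y) \<in> splits w. (-1) ^ length x * ?h x * ?e y)"
      by (simp add: coproduct_sum split_def coproduct_mult Delta_minus_one_power mult.assoc)
    also have "\<dots> = 0"
      \<comment> \<open>Scaling by \<open>0\<close> supplies that \<open>\<Delta>\<close> maps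
        \<open>0\<close> to \<open>0\<close>.\<close>
      using False coproduct_scale[of 0 "0 :: ('a, 'k) nsym"] by (simp add: sum_H_E_word)
    finally have D: "(\<Sum>(x, y) \<in> splits w. (-1) ^ length x * \<Delta> (?h x) * \<Delta> (?e y)) = 0" .
    \<comment> \<open>In \<open>?S\<close> the first factor is nonempty, so \<open>y\<close> is
      shorter than \<open>w\<close>.\<close>
    have IH: "(\<Sum>(x, y) \<in> ?S. (-1) ^ length x * \<Delta> (?h x) * \<Delta> (?e y)) =
      (\<Sum>(x, y) \<in> ?S. (-1) ^ length x * \<Delta> (?h x) * ?F y)"
    proof -
      have eq: "\<Delta> (?e y) = ?F y" if "(x, y) \<in> ?S" for x y
      proof -
        have "length y < length w" using that by (cases x) (auto simp: splits_def)
        then show ?thesis by (rule less)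
      qed
      show ?thesis by (intro sum.cong refl) (simp only: split_paired_all prod.case eq)
    qed
    \<comment> \<open>Isolates the term with empty \<open>x\<close>, whose coefficient is
      \<open>1\<close>; applied to \<open>D\<close> and \<open>F\<close>, it expresses both
      candidate values at \<open>w\<close> by the same sum over \<open>?S\<close>.\<close>
    have rem: "(\<Sum>(x, y) \<in> splits w. (-1) ^ length x * \<Delta> (?h x) * f y) =
      f w + (\<Sum>(x, y) \<in> ?S. (-1) ^ length x * \<Delta> (?h x) * f y)" for f
      by (simp add: sum.remove[of _ "([], w)"] H_empty coproduct_one)
    from D have "\<Delta> (?e w) = - (\<Sum>(x, y) \<in> ?S. (-1) ^ length x * \<Delta> (?h x) * ?F y)"
      unfolding rem[of "\<lambda>y. \<Delta> (?e y)"] IH eq_neg_iff_add_eq_0 .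
    also from F have "\<dots> = ?F w"
      unfolding rem[of ?F] eq_neg_iff_add_eq_0[symmetric] by (rule sym)
    finally show ?thesis .
  qed
qed

lemma coproduct_E:
  "\<Delta> (E I :: ('a, 'k::field) nsym) = (\<Sum>J | J \<sqsubset> I. E (strip J) \<otimes> E (strip (I \<setminus> J)))"
proof (induction I rule: sentence_induct)
  case zero
  show ?case by (simp add: E_empty coproduct_one one_tensor_one)
next
  case (plus w I)
  \<comment> \<open>The swap of factors sits here: the complement \<open>U\<close> comes first as an
    argument but goes into the right tensor factor.\<close>
  let ?\<phi> = "\<lambda>U J. E J \<otimes> E U :: ('a sentence \<times> 'a sentence \<Rightarrow>\<^sub>0 'k)"
  have "\<Delta> (E (strip [w] + I) :: ('a, 'k) nsym) = \<Delta> (E (strip [w])) * \<Delta> (E I)"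
    by (simp add: E_plus coproduct_mult)
  also have "\<Delta> (E (strip [w]) :: ('a, 'k) nsym) =
      (\<Sum>J | J \<sqsubset> strip [w]. ?\<phi> (strip (strip [w] \<setminus> J)) (strip J))"
    unfolding coproduct_E_word by (rule sum_weak_sub_word[symmetric])
  also note plus.IH
  finally show ?case
    by (subst sum_weak_sub_plus[where \<phi> = ?\<phi>]) (simp_all add: E_plus tensor_mult)
qed

theorem proposition3p12:
  fixes A :: "'a set"
  assumes "finite A"
  shows "(\<forall>I \<in> sentences A.
            \<Delta> (E I :: ('a, 'k::field_char_0) nsym) =
              (\<Sum>J | J \<sqsubset> I. E (strip J) \<otimes> E (strip (I \<setminus> J))))
       \<and> (\<forall>w \<in> lists A.
            \<Delta> (E (strip [w]) :: ('a, 'k) nsym) =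
              (\<Sum>j = 0..length w. E (strip [drop j w]) \<otimes> E (strip [take j w])))"
  \<comment> \<open>In the second part factorizations become cut positions; at \<open>j = 0\<close>
    the right factor, and at \<open>j = length w\<close> the left one, is
    \<open>E 0 = 1\<close>.\<close>
  by (simp add: coproduct_E[symmetric] coproduct_E_word sum_splits)

end
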